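(* Let $\epsilon>0$. For every instance of \textsc{L-Sided Pricing} on a simple graph in which $\mu_v\ge 3\ln(1/\epsilon)/\epsilon^2+1$ for all $v\in R$, the optimum revenue of the instance is at least $(1-2\epsilon)$ times the optimum value of the linear program (LP-Pricing).
   Context: An instance of \textsc{L-Sided Pricing} consists of a finite bipartite graph $G=(L\cup R,E)$ (each edge joins $L$ and $R$; simple means no parallel edges), a capacity $\mu_w\in\mathbb Z_{\ge 0}\cup\{\infty\}$ for every vertex $w$, and a budget $b_e\ge 0$ for every edge $e$. A feasible solution is a pair $(p,F)$ with $p:L\cup R\to\mathbb R_{\ge0}$, $p(v)=0$ for $v\in R$, $F\subseteq E$, $p(u)+p(v)\le b_e$ for every $e=uv\in F$, and every vertex $w$ incident to at most $\mu_w$ edges of $F$; its revenue is $\sum_{e=uv\in F}(p(u)+p(v))$. For $u\in L$ let $P_u=\{b_e:e\in E\text{ incident to }u\}$ and $\delta(w)$ the set of edges incident to $w$. (LP-Pricing) has variables $y_{u,p}\ge0$ for $u\in L$, $p\in P_u$, and $x_{e,p}\ge 0$ for each edge $e=uv$ ($u\in L$) and $p\in P_u$ with $p\le b_e$; it maximizes $\sum_{e=uv}\sum_{p\in P_u}p\,x_{e,p}$ subject to: $\sum_{p\in P_u}y_{u,p}=1$ for all $u\in L$; $\sum_{e\in\delta(u)}x_{e,p}\le \mu_u\,y_{u,p}$ for all $u\in L$, $p\in P_u$; $\sum_{e=uv\in\delta(v)}\sum_{p\in P_u}x_{e,p}\le\mu_v$ for all $v\in R$; $x_{e,p}\le y_{u,p}$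 for all $u\in L$, $e\in\delta(u)$, $p\in P_u$ with $p\le b_e$ (sums range only over defined variables). *)

theory Defs
  imports "HOL-Analysis.Analysis" "HOL-Library.Extended_Nat"
begin

text \<open>Edges carry their own names, so that parallel edges are possible in general and
  simplicity is a genuine property; an edge \<open>e\<close> joins \<open>lend e\<close> to \<open>rend e\<close>.\<close>

record ('v, 'e) pricing =
  lverts :: "'v set"
  rverts :: "'v set"
  edges :: "'e set"
  lend :: "'e \<Rightarrow> 'v"
  rend :: "'e \<Rightarrow> 'v"
  cap :: "'v \<Rightarrow> enat"
  budget :: "'e \<Rightarrow> real"

definition pricing_instance :: "('v, 'e) pricing \<Rightarrow> bool" where
  "pricing_instance I \<longleftrightarrow>
     finite (lverts I) \<and> finite (rverts I) \<and> finite (edges I) \<and>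
     lverts I \<inter> rverts I = {} \<and>
     (\<forall>e\<in>edges I. lend I e \<in> lverts I \<and> rend I e \<in> rverts I \<and> budget I e \<ge> 0)"

definition simple_instance :: "('v, 'e) pricing \<Rightarrow> bool" where
  "simple_instance I \<longleftrightarrow> inj_on (\<lambda>e. (lend I e, rend I e)) (edges I)"

definition incident :: "('v, 'e) pricing \<Rightarrow> 'v \<Rightarrow> 'e set" where
  "incident I w = {e \<in> edges I. lend I e = w \<or> rend I e = w}"

definition feasible :: "('v, 'e) pricing \<Rightarrow> ('v \<Rightarrow> real) \<Rightarrow> 'e set \<Rightarrow> bool" where
  "feasible I p F \<longleftrightarrow>
     (\<forall>w\<in>lverts I \<union> rverts I. p w \<ge> 0) \<and>
     (\<forall>v\<in>rverts I. p v = 0) \<and>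
     F \<subseteq> edges I \<and>
     (\<forall>e\<in>F. p (lend I e) + p (rend I e) \<le> budget I e) \<and>
     (\<forall>w\<in>lverts I \<union> rverts I. enat (card (F \<inter> incident I w)) \<le> cap I w)"

definition revenue :: "('v, 'e) pricing \<Rightarrow> ('v \<Rightarrow> real) \<Rightarrow> 'e set \<Rightarrow> real" where
  "revenue I p F = (\<Sum>e\<in>F. p (lend I e) + p (rend I e))"

definition prices :: "('v, 'e) pricing \<Rightarrow> 'v \<Rightarrow> real set" where
  "prices I u = budget I ` incident I u"

text \<open>The variable \<open>x e p\<close> of the linear program exists only for \<open>p \<in> edge_prices I e\<close>,
  and \<open>y u p\<close> only for \<open>u \<in> lverts I\<close> and \<open>p \<in> prices I u\<close>; values of the functions elsewhere
  are unconstrained and enter neither the constraints nor the objective.\<close>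

definition edge_prices :: "('v, 'e) pricing \<Rightarrow> 'e \<Rightarrow> real set" where
  "edge_prices I e = {p \<in> prices I (lend I e). p \<le> budget I e}"

text \<open>With \<open>cap I u = \<infinity>\<close> the capacity constraint at \<open>u\<close> is void: for \<open>y u p > 0\<close> its right-hand
  side is \<open>\<infinity>\<close>, and for \<open>y u p = 0\<close> it is \<open>\<infinity> * 0 = 0\<close>, but then all \<open>x e p\<close> in the sum
  vanish by the last constraint.\<close>

definition lp_feasible ::
  "('v, 'e) pricing \<Rightarrow> ('e \<Rightarrow> real \<Rightarrow> real) \<Rightarrow> ('v \<Rightarrow> real \<Rightarrow> real) \<Rightarrow> bool" where
  "lp_feasible I x y \<longleftrightarrow>
     (\<forall>u\<in>lverts I. \<forall>p\<in>prices I u. y u p \<ge> 0) \<and>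
     (\<forall>e\<in>edges I. \<forall>p\<in>edge_prices I e. x e p \<ge> 0) \<and>
     (\<forall>u\<in>lverts I. (\<Sum>p\<in>prices I u. y u p) = 1) \<and>
     (\<forall>u\<in>lverts I. \<forall>p\<in>prices I u.
        ereal (\<Sum>e | e \<in> incident I u \<and> p \<le> budget I e. x e p)
          \<le> ereal_of_enat (cap I u) * ereal (y u p)) \<and>
     (\<forall>v\<in>rverts I.
        ereal (\<Sum>e\<in>incident I v. \<Sum>p\<in>edge_prices I e. x e p) \<le> ereal_of_enat (cap I v)) \<and>
     (\<forall>u\<in>lverts I. \<forall>e\<in>incident I u. \<forall>p\<in>edge_prices I e. x e p \<le> y u p)"

definition lp_value :: "('v, 'e) pricing \<Rightarrow> ('e \<Rightarrow> real \<Rightarrow> real) \<Rightarrow> real" where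
  "lp_value I x = (\<Sum>e\<in>edges I. \<Sum>p\<in>edge_prices I e. p * x e p)"

definition is_maximum :: "real set \<Rightarrow> real \<Rightarrow> bool" where
  "is_maximum S z \<longleftrightarrow> z \<in> S \<and> (\<forall>s\<in>S. s \<le> z)"

definition optimum_revenue :: "('v, 'e) pricing \<Rightarrow> real \<Rightarrow> bool" where
  "optimum_revenue I r \<longleftrightarrow> is_maximum {revenue I p F | p F. feasible I p F} r"

definition lp_optimum :: "('v, 'e) pricing \<Rightarrow> real \<Rightarrow> bool" where
  "lp_optimum I z \<longleftrightarrow> is_maximum {lp_value I x | x y. lp_feasible I x y} z"

text \<open>A vertex of \<open>lverts I\<close> without incident edges makes the equality constraint
  \<open>0 = 1\<close>; apart from that the linear program is feasible and its optimum is attained, so that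
  \<open>lp_optimum I\<close> holds for exactly one value.\<close>

lemma is_maximum_unique: "is_maximum S a \<Longrightarrow> is_maximum S b \<Longrightarrow> a = b"
  unfolding is_maximum_def by (meson order_antisym)

lemma compact_box_fun2:
  fixes S :: "'a \<Rightarrow> 'b \<Rightarrow> real set"
  assumes "\<And>a b. compact (S a b)"
  shows "compact {f. \<forall>a b. f a b \<in> S a b}"
proof -
  have 1: "compact (PiE UNIV (S a))" for a
    using compactin_PiE[of "\<lambda>_. euclidean" UNIV "S a"] assms
    by (simp add: euclidean_product_topology)
  have "compact (PiE UNIV (\<lambda>a. PiE UNIV (S a)))"
    using compactin_PiE[of "\<lambda>_. euclidean" UNIV "\<lambda>a. PiE UNIV (S a)"] 1
    by (simp add: euclidean_product_topology)
  moreover have "PiE UNIV (\<lambda>a. PiE UNIV (S a)) = {f. \<forall>a b. f a b \<in> S a b}"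
    by (auto simp: PiE_def Pi_def)
  ultimately show ?thesis by simp
qed

lemma continuous_on_apply2:
  fixes g :: "'c::topological_space \<Rightarrow> 'a \<Rightarrow> 'b \<Rightarrow> real"
  assumes "continuous_on UNIV g"
  shows "continuous_on UNIV (\<lambda>z. g z a b)"
  using continuous_on_product_then_coordinatewise[OF continuous_on_product_then_coordinatewise[OF assms]] .

lemma lp_feasible_exists:
  assumes inst: "pricing_instance I"
    and ne: "\<And>u. u \<in> lverts I \<Longrightarrow> incident I u \<noteq> {}"
  shows "\<exists>x y. lp_feasible I x y"
proof -
  have fin: "finite (prices I u)" for u
    using inst by (auto simp: pricing_instance_def prices_def incident_def)
  have "lp_feasible I (\<lambda>_ _. 0) (\<lambda>u _. 1 / real (card (prices I u)))"
    unfolding lp_feasible_def using fin ne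
    by (auto simp: prices_def ereal_0_le_mult zero_ereal_def[symmetric])
  then show ?thesis by blast
qed

lemma lp_optimum_exists:
  fixes I :: "('b, 'a) pricing"
  assumes inst: "pricing_instance I"
    and ne: "\<And>u. u \<in> lverts I \<Longrightarrow> incident I u \<noteq> {}"
  shows "\<exists>z. lp_optimum I z"
proof -
  have fin: "finite (prices I u)" for u
    using inst by (auto simp: pricing_instance_def prices_def incident_def)
  have lr: "lend I e \<in> lverts I" "e \<in> incident I (lend I e)" if "e \<in> edges I" for e
    using inst that by (auto simp: pricing_instance_def incident_def)
  have ule: "lend I e = u \<and> e \<in> edges I" if "u \<in> lverts I" "e \<in> incident I u" for u e
    using inst that by (auto simp: pricing_instance_def incident_def)
  define X where "X e p = (if e \<in> edges I \<and> p \<in> edge_prices I e then {0..1::real} else {0})" for e p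
  define Y where "Y u p = (if u \<in> lverts I \<and> p \<in> prices I u then {0..1::real} else {0})" for u p
  define C where "C = {z::('a \<Rightarrow> real \<Rightarrow> real) \<times> ('b \<Rightarrow> real \<Rightarrow> real).
     (\<forall>u\<in>lverts I. (\<Sum>p\<in>prices I u. snd z u p) = 1) \<and>
     (\<forall>u\<in>lverts I. \<forall>p\<in>prices I u. \<forall>n. cap I u = enat n \<longrightarrow>
        (\<Sum>e | e \<in> incident I u \<and> p \<le> budget I e. fst z e p) \<le> real n * snd z u p) \<and>
     (\<forall>v\<in>rverts I. \<forall>n. cap I v = enat n \<longrightarrow>
        (\<Sum>e\<in>incident I v. \<Sum>p\<in>edge_prices I e. fst z e p) \<le> real n) \<and>
     (\<forall>u\<in>lverts I. \<forall>e\<in>incident I u. \<forall>p\<in>edge_prices I e. fst z e p \<le> snd z u p)}"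
  define K where "K = ({x. \<forall>e p. x e p \<in> X e p} \<times> {y. \<forall>u p. y u p \<in> Y u p}) \<inter> C"
  have cont: "continuous_on UNIV (\<lambda>z::('a \<Rightarrow> real \<Rightarrow> real) \<times> ('b \<Rightarrow> real \<Rightarrow> real). fst z a b)"
    "continuous_on UNIV (\<lambda>z::('a \<Rightarrow> real \<Rightarrow> real) \<times> ('b \<Rightarrow> real \<Rightarrow> real). snd z c d)" for a b c d
    by (intro continuous_on_apply2 continuous_intros)+
  have "closed C"
    unfolding C_def Ball_def
    by (intro closed_Collect_conj closed_Collect_all closed_Collect_imp
        closed_Collect_le closed_Collect_eq open_Collect_const continuous_intros cont)
  then have "compact K"
    unfolding K_def X_def Y_def
    by (intro compact_Int_closed compact_Times compact_box_fun2) auto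
  have capL: "ereal (\<Sum>e | e \<in> incident I u \<and> p \<le> budget I e. x e p)
          \<le> ereal_of_enat (cap I u) * ereal (y u p) \<longleftrightarrow>
       (\<forall>n. cap I u = enat n \<longrightarrow>
          (\<Sum>e | e \<in> incident I u \<and> p \<le> budget I e. x e p) \<le> real n * y u p)"
    if u: "u \<in> lverts I" and p: "p \<in> prices I u" and y: "y u p \<ge> 0"
      and xy: "\<forall>e\<in>incident I u. \<forall>p\<in>edge_prices I e. x e p \<le> y u p" for x :: "'a \<Rightarrow> real \<Rightarrow> real" and y u p
  proof (cases "cap I u")
    case (enat n)
    then show ?thesis by simp
  next
    case infinity
    have "(\<Sum>e | e \<in> incident I u \<and> p \<le> budget I e. x e p) \<le> 0" if "y u p = 0"
      using xy ule[OF u] p that by (intro sum_nonpos) (fastforce simp: edge_prices_def)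
    with infinity y show ?thesis by (cases "y u p = 0") auto
  qed
  have capR: "ereal s \<le> ereal_of_enat c \<longleftrightarrow> (\<forall>n. c = enat n \<longrightarrow> s \<le> real n)" for s c
    by (cases c) auto
  have inK: "\<exists>z\<in>K. lp_value I (fst z) = lp_value I x" if xy: "lp_feasible I x y" for x y
  proof -
    define x' where "x' e p = (if e \<in> edges I \<and> p \<in> edge_prices I e then x e p else 0)" for e p
    define y' where "y' u p = (if u \<in> lverts I \<and> p \<in> prices I u then y u p else 0)" for u p
    have y1: "y u p \<le> 1" if "u \<in> lverts I" "p \<in> prices I u" for u p
      using member_le_sum[of p "prices I u" "y u"] xy that fin
      by (auto simp: lp_feasible_def)
    have x1: "x e p \<le> 1" if "e \<in> edges I" "p \<in> edge_prices I e" for e p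
      using xy that lr y1 unfolding lp_feasible_def edge_prices_def
      by (smt (verit, best) mem_Collect_eq)
    have s1: "(\<Sum>e | e \<in> incident I u \<and> p \<le> budget I e. x' e p)
        = (\<Sum>e | e \<in> incident I u \<and> p \<le> budget I e. x e p)" if "u \<in> lverts I" "p \<in> prices I u" for u p
      using that ule by (intro sum.cong) (auto simp: x'_def edge_prices_def)
    have s2: "(\<Sum>e\<in>incident I v. \<Sum>p\<in>edge_prices I e. x' e p)
        = (\<Sum>e\<in>incident I v. \<Sum>p\<in>edge_prices I e. x e p)" for v
      by (intro sum.cong) (auto simp: x'_def incident_def)
    have sub: "p \<in> prices I u" if "u \<in> lverts I" "e \<in> incident I u" "p \<in> edge_prices I e" for u e p
      using that ule by (auto simp: edge_prices_def)
    have F: "\<forall>u\<in>lverts I. \<forall>p\<in>prices I u. y u p \<ge> 0"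
      "\<forall>e\<in>edges I. \<forall>p\<in>edge_prices I e. x e p \<ge> 0"
      "\<forall>u\<in>lverts I. (\<Sum>p\<in>prices I u. y u p) = 1"
      "\<forall>u\<in>lverts I. \<forall>p\<in>prices I u.
        ereal (\<Sum>e | e \<in> incident I u \<and> p \<le> budget I e. x e p)
          \<le> ereal_of_enat (cap I u) * ereal (y u p)"
      "\<forall>v\<in>rverts I.
        ereal (\<Sum>e\<in>incident I v. \<Sum>p\<in>edge_prices I e. x e p) \<le> ereal_of_enat (cap I v)"
      "\<forall>u\<in>lverts I. \<forall>e\<in>incident I u. \<forall>p\<in>edge_prices I e. x e p \<le> y u p"
      using xy unfolding lp_feasible_def by blast+
    have "(x', y') \<in> C"
      unfolding C_def mem_Collect_eq fst_conv snd_conv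
    proof (intro conjI ballI allI impI)
      fix u assume u: "u \<in> lverts I"
      show "(\<Sum>p\<in>prices I u. y' u p) = 1" using F(3) u by (simp add: y'_def)
      fix p n assume p: "p \<in> prices I u" and n: "cap I u = enat n"
      show "(\<Sum>e | e \<in> incident I u \<and> p \<le> budget I e. x' e p) \<le> real n * y' u p"
        using F(4) u p n by (force simp: s1 y'_def)
    next
      fix v n assume "v \<in> rverts I" "cap I v = enat n"
      then show "(\<Sum>e\<in>incident I v. \<Sum>p\<in>edge_prices I e. x' e p) \<le> real n"
        using F(5) by (force simp: s2)
    next
      fix u e p assume "u \<in> lverts I" "e \<in> incident I u" "p \<in> edge_prices I e"
      then show "x' e p \<le> y' u p" using F(6) ule sub by (auto simp: x'_def y'_def)
    qed
    moreover have "x' e p \<in> X e p" for e p using F(2) x1 by (auto simp: x'_def X_def)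
    moreover have "y' u p \<in> Y u p" for u p using F(1) y1 by (auto simp: y'_def Y_def)
    ultimately have "(x', y') \<in> K" by (simp add: K_def)
    moreover have "lp_value I x' = lp_value I x"
      unfolding lp_value_def by (intro sum.cong) (auto simp: x'_def)
    ultimately show ?thesis by force
  qed
  have Kfeas: "lp_feasible I (fst z) (snd z)" if z: "z \<in> K" for z
  proof -
    have y0: "snd z u p \<ge> 0" for u p
    proof -
      have "snd z u p \<in> Y u p" using z by (auto simp: K_def)
      then show ?thesis by (auto simp: Y_def split: if_splits)
    qed
    have x0: "fst z e p \<ge> 0" for e p
    proof -
      have "fst z e p \<in> X e p" using z by (auto simp: K_def)
      then show ?thesis by (auto simp: X_def split: if_splits)
    qed
    have zC: "z \<in> C" using z by (simp add: K_def)
    then have C: "\<forall>u\<in>lverts I. (\<Sum>p\<in>prices I u. snd z u p) = 1"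
      "\<forall>u\<in>lverts I. \<forall>p\<in>prices I u. \<forall>n. cap I u = enat n \<longrightarrow>
        (\<Sum>e | e \<in> incident I u \<and> p \<le> budget I e. fst z e p) \<le> real n * snd z u p"
      "\<forall>v\<in>rverts I. \<forall>n. cap I v = enat n \<longrightarrow>
        (\<Sum>e\<in>incident I v. \<Sum>p\<in>edge_prices I e. fst z e p) \<le> real n"
      "\<forall>u\<in>lverts I. \<forall>e\<in>incident I u. \<forall>p\<in>edge_prices I e. fst z e p \<le> snd z u p"
      unfolding C_def by blast+
    have "ereal (\<Sum>e | e \<in> incident I u \<and> p \<le> budget I e. fst z e p)
          \<le> ereal_of_enat (cap I u) * ereal (snd z u p)" if "u \<in> lverts I" "p \<in> prices I u" for u p
      using capL[of u p "snd z" "fst z"] that y0 C(2,4) by blast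
    then show ?thesis
      unfolding lp_feasible_def capR using x0 y0 C by blast
  qed
  have "K \<noteq> {}" using lp_feasible_exists[OF assms] inK by blast
  moreover have "continuous_on K (\<lambda>z. lp_value I (fst z))"
    unfolding lp_value_def
    by (rule continuous_on_subset[OF _ subset_UNIV]) (intro continuous_intros cont)
  ultimately obtain z where z: "z \<in> K" "\<forall>w\<in>K. lp_value I (fst w) \<le> lp_value I (fst z)"
    using continuous_attains_sup \<open>compact K\<close> by blast
  have "lp_optimum I (lp_value I (fst z))"
    unfolding lp_optimum_def is_maximum_def
  proof (intro conjI ballI)
    show "lp_value I (fst z) \<in> {lp_value I x |x y. lp_feasible I x y}"
      using Kfeas[OF z(1)] by blast
  next
    fix s assume "s \<in> {lp_value I x |x y. lp_feasible I x y}"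
    then show "s \<le> lp_value I (fst z)" using inK z(2) by force
  qed
  then show ?thesis ..
qed

end

theory Submission
  imports Defs "HOL-Probability.Product_PMF"
begin

text \<open>Round a solution of the linear program: independently for each left vertex \<open>u\<close> draw a price
  \<open>p\<close> with probability \<open>y u p\<close> and, given \<open>p\<close>, a set of at most \<open>cap I u\<close> edges at \<open>u\<close>
  containing \<open>e\<close> with probability \<open>(1 - \<epsilon>) * x e p / y u p\<close>; such a random set exists because the
  polytope of vectors in \<open>[0,1]\<^sup>n\<close> with coordinate sum at most an integer \<open>k\<close> is integral. Then
  drop every edge whose right end is filled up by other drawn edges. In a simple graph these other
  edges are drawn independently of each other and of \<open>e\<close>, and the factor \<open>1 - \<epsilon>\<close> keeps their
  expected number away from the capacity, so by a Chernoff bound \<open>e\<close> is dropped with probability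
  at most \<open>\<epsilon>\<close>. The expected revenue is therefore at least \<open>(1 - \<epsilon>)\<^sup>2\<close> times the value of the linear
  program.\<close>

subsection \<open>Products of probability mass functions\<close>

lemma measure_bind_pmf:
  "measure_pmf.prob (bind_pmf M N) X = measure_pmf.expectation M (\<lambda>a. measure_pmf.prob (N a) X)"
  using measurable_measure_pmf[of N] unfolding measure_pmf_bind
  by (subst measure_pmf.measure_bind[where N = "count_space UNIV"]) auto

lemma measure_bind_pmf_map_Pair:
  "measure_pmf.prob (bind_pmf M (\<lambda>a. map_pmf (Pair a) (N a))) ({a} \<times> B)
    = pmf M a * measure_pmf.prob (N a) B"
proof -
  have "measure_pmf.prob (map_pmf (Pair a') (N a')) ({a} \<times> B)
      = measure_pmf.prob (N a) B * indicat_real {a} a'" for a'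
    by (cases "a' = a") (auto simp: vimage_def)
  then show ?thesis
    by (simp add: measure_bind_pmf pmf.rep_eq)
qed

lemma pmf_of_weights_exists:
  fixes w :: "'a \<Rightarrow> real"
  assumes "finite A" "\<And>a. a \<in> A \<Longrightarrow> 0 \<le> w a" "sum w A = 1"
  shows "\<exists>D. set_pmf D \<subseteq> A \<and> (\<forall>a\<in>A. pmf D a = w a)"
proof -
  define f where "f a = (if a \<in> A then w a else 0)" for a
  have nonneg: "0 \<le> f a" for a
    using assms(2) by (simp add: f_def)
  have "(\<integral>\<^sup>+a. f a \<partial>count_space UNIV) = (\<Sum>a\<in>A. ennreal (f a))"
    using assms(1) by (intro nn_integral_count_space') (auto simp: f_def)
  also have "\<dots> = ennreal (sum w A)"
    using assms(2) by (subst sum_ennreal) (auto simp: f_def)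
  finally have total: "(\<integral>\<^sup>+a. f a \<partial>count_space UNIV) = 1"
    using assms(3) by simp
  have "set_pmf (embed_pmf f) \<subseteq> A"
    by (auto simp: set_embed_pmf[OF nonneg total] f_def)
  moreover have "\<forall>a\<in>A. pmf (embed_pmf f) a = w a"
    by (simp add: pmf_embed_pmf[OF nonneg total] f_def)
  ultimately show ?thesis by blast
qed

lemma measure_pair_pmf_Times:
  "measure_pmf.prob (pair_pmf M N) (A \<times> B) = measure_pmf.prob M A * measure_pmf.prob N B"
proof -
  have "(A \<times> B) \<inter> set_pmf (pair_pmf M N) = (A \<inter> set_pmf M) \<times> (B \<inter> set_pmf N)"
    by auto
  then have "measure_pmf.prob (pair_pmf M N) (A \<times> B)
      = measure_pmf.prob (pair_pmf M N) ((A \<inter> set_pmf M) \<times> (B \<inter> set_pmf N))"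
    by (metis measure_Int_set_pmf)
  also have "\<dots> = measure_pmf.prob M A * measure_pmf.prob N B"
    by (subst measure_pmf_prob_product) (auto simp: measure_Int_set_pmf)
  finally show ?thesis .
qed

lemma measure_Pi_pmf_coordinate_indep:
  assumes "finite A" "a \<in> A" and indep: "\<And>g b. Q (g(a := b)) \<longleftrightarrow> Q g"
  shows "measure_pmf.prob (Pi_pmf A d D) {g. g a \<in> B \<and> Q g}
    = measure_pmf.prob (D a) B * measure_pmf.prob (Pi_pmf A d D) {g. Q g}"
proof -
  let ?rest = "Pi_pmf (A - {a}) d D"
  have split: "measure_pmf.prob (Pi_pmf A d D) {g. g a \<in> C \<and> Q g}
      = measure_pmf.prob (D a) C * measure_pmf.prob ?rest {g. Q g}" for C
  proof -
    have "Pi_pmf A d D = map_pmf (\<lambda>(b, g). g(a := b)) (pair_pmf (D a) ?rest)"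
      using Pi_pmf_insert[of "A - {a}" a d D] assms(1,2) by (simp add: insert_absorb)
    moreover have "(\<lambda>(b, g). g(a := b)) -` {g. g a \<in> C \<and> Q g} = C \<times> {g. Q g}"
      using indep by auto
    ultimately show ?thesis
      by (simp add: measure_pair_pmf_Times)
  qed
  from split[of UNIV] split[of B] show ?thesis by simp
qed

lemma (in prob_space) indep_sets_reindex:
  assumes inj: "inj_on f J" and indep: "indep_sets F (f ` J)"
  shows "indep_sets (\<lambda>j. F (f j)) J"
proof (rule indep_setsI)
  show "F (f j) \<subseteq> events" if "j \<in> J" for j
    using indep that by (auto simp: indep_sets_def)
next
  fix A K
  assume subset: "K \<noteq> {}" "K \<subseteq> J" "finite K" and A_sets: "\<forall>j\<in>K. A j \<in> F (f j)"
  define B where "B i = A (the_inv_into K f i)" for i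
  have inj_K: "inj_on f K"
    using inj subset(2) by (rule inj_on_subset)
  have B_f: "B (f j) = A j" if "j \<in> K" for j
    using that inj_K by (simp add: B_def the_inv_into_f_f)
  have "prob (\<Inter>i\<in>f ` K. B i) = (\<Prod>i\<in>f ` K. prob (B i))"
    using indep subset A_sets B_f by (intro indep_setsD) auto
  then show "prob (\<Inter>j\<in>K. A j) = (\<Prod>j\<in>K. prob (A j))"
    using B_f by (simp add: prod.reindex[OF inj_K])
qed

lemma (in prob_space) indep_vars_reindex:
  assumes "inj_on f J" "indep_vars M' X (f ` J)"
  shows "indep_vars (\<lambda>j. M' (f j)) (\<lambda>j. X (f j)) J"
  using assms(2) indep_sets_reindex[OF assms(1)] unfolding indep_vars_def2 by auto

lemma indep_vars_Pi_pmf_reindex: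
  assumes "finite A" "inj_on f J" "f ` J \<subseteq> A"
  shows "prob_space.indep_vars (measure_pmf (Pi_pmf A d D)) (\<lambda>_. count_space UNIV)
    (\<lambda>j g. X j (g (f j))) J"
proof -
  let ?M = "measure_pmf (Pi_pmf A d D)"
  have "prob_space.indep_vars ?M (\<lambda>_. count_space UNIV) (\<lambda>a g. g a) (f ` J)"
    by (rule prob_space.indep_vars_subset
        [OF prob_space_measure_pmf indep_vars_Pi_pmf[OF assms(1)] assms(3)])
  from prob_space.indep_vars_reindex[OF prob_space_measure_pmf assms(2) this] show ?thesis
    by (rule prob_space.indep_vars_compose2[OF prob_space_measure_pmf]) simp
qed


subsection \<open>A Chernoff bound\<close>

lemma (in prob_space)
  fixes X :: "'i \<Rightarrow> 'a \<Rightarrow> bool"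
  assumes fin: "finite J" and indep: "indep_vars (\<lambda>_. count_space UNIV) X J" and t_ge_1: "1 \<le> t"
  shows integrable_power_card: "integrable M (\<lambda>\<omega>. t ^ card {j \<in> J. X j \<omega>})"
    and expectation_power_card_le: "expectation (\<lambda>\<omega>. t ^ card {j \<in> J. X j \<omega>})
      \<le> exp ((t - 1) * (\<Sum>j\<in>J. prob {\<omega> \<in> space M. X j \<omega>}))"
proof -
  let ?p = "\<lambda>j. prob {\<omega> \<in> space M. X j \<omega>}"
  define Z where "Z j \<omega> = (if X j \<omega> then t else 1)" for j \<omega>
  have [measurable]: "X j \<in> measurable M (count_space UNIV)" if "j \<in> J" for j
    using indep that by (auto simp: indep_vars_def)
  have prod_Z: "(\<Prod>j\<in>J. Z j \<omega>) = t ^ card {j \<in> J. X j \<omega>}" for \<omega>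
    using fin by (simp add: Z_def prod.If_cases Int_def)
  have indep_Z: "indep_vars (\<lambda>_. borel) Z J"
    unfolding Z_def using indep by (rule indep_vars_compose2) simp
  have integrable_Z: "integrable M (Z j)" if "j \<in> J" for j
    using that t_ge_1 indep_Z
    by (intro integrable_const_bound[where B = t]) (auto simp: Z_def indep_vars_def)
  show "integrable M (\<lambda>\<omega>. t ^ card {j \<in> J. X j \<omega>})"
    using indep_vars_integrable[OF fin indep_Z integrable_Z] by (simp add: prod_Z)
  have expectation_Z: "expectation (Z j) = 1 + (t - 1) * ?p j" if "j \<in> J" for j
  proof -
    have "expectation (Z j)
        = expectation (\<lambda>\<omega>. 1 + (t - 1) * indicat_real {\<omega> \<in> space M. X j \<omega>} \<omega>)"
      by (intro Bochner_Integration.integral_cong) (auto simp: Z_def)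
    moreover have "{\<omega> \<in> space M. X j \<omega>} \<in> events"
      using that by measurable
    ultimately show ?thesis
      by (simp add: prob_space less_top[symmetric])
  qed
  have "expectation (\<lambda>\<omega>. t ^ card {j \<in> J. X j \<omega>}) = (\<Prod>j\<in>J. 1 + (t - 1) * ?p j)"
    using indep_vars_lebesgue_integral[OF fin indep_Z integrable_Z] expectation_Z
    by (simp add: prod_Z)
  also have "\<dots> \<le> (\<Prod>j\<in>J. exp ((t - 1) * ?p j))"
    using t_ge_1 by (intro prod_mono) simp
  also have "\<dots> = exp ((t - 1) * (\<Sum>j\<in>J. ?p j))"
    using fin by (simp add: exp_sum sum_distrib_left)
  finally show "expectation (\<lambda>\<omega>. t ^ card {j \<in> J. X j \<omega>}) \<le> exp ((t - 1) * (\<Sum>j\<in>J. ?p j))" .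
qed

lemma (in prob_space) Chernoff_upper_tail:
  fixes X :: "'i \<Rightarrow> 'a \<Rightarrow> bool"
  assumes fin: "finite J" and indep: "indep_vars (\<lambda>_. count_space UNIV) X J"
    and t_ge_1: "1 \<le> t" and mean: "(\<Sum>j\<in>J. prob {\<omega> \<in> space M. X j \<omega>}) \<le> \<mu>"
  shows "prob {\<omega> \<in> space M. k \<le> card {j \<in> J. X j \<omega>}} \<le> exp ((t - 1) * \<mu>) / t ^ k"
proof -
  let ?N = "\<lambda>\<omega>. card {j \<in> J. X j \<omega>}"
  have "prob {\<omega> \<in> space M. k \<le> ?N \<omega>} \<le> prob {\<omega> \<in> space M. t ^ k \<le> t ^ ?N \<omega>}"
  proof (rule finite_measure_mono)
    show "{\<omega> \<in> space M. k \<le> ?N \<omega>} \<subseteq> {\<omega> \<in> space M. t ^ k \<le> t ^ ?N \<omega>}"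
      using t_ge_1 by (auto intro: power_increasing)
  qed (use integrable_power_card[OF fin indep t_ge_1] in measurable)
  also have "\<dots> \<le> expectation (\<lambda>\<omega>. t ^ ?N \<omega>) / t ^ k"
    using t_ge_1 integrable_power_card[OF fin indep t_ge_1]
    by (intro integral_Markov_inequality_measure[where A = "{}"]) auto
  also have "expectation (\<lambda>\<omega>. t ^ ?N \<omega>) \<le> exp ((t - 1) * \<mu>)"
    using expectation_power_card_le[OF fin indep t_ge_1]
    by (rule order_trans) (use t_ge_1 mean in \<open>simp add: mult_left_mono\<close>)
  finally show ?thesis
    using t_ge_1 by (simp add: divide_right_mono)
qed

lemma ln_one_minus_le:
  fixes x :: real
  assumes "0 \<le> x" "x < 1"
  shows "ln (1 - x) \<le> - x - x\<^sup>2 / 2"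
proof -
  let ?f = "\<lambda>x::real. - x - x\<^sup>2 / 2 - ln (1 - x)"
  have "?f 0 \<le> ?f x"
  proof (rule DERIV_nonneg_imp_nondecreasing[OF assms(1)])
    fix y assume "0 \<le> y" "y \<le> x"
    then have "y < 1" using assms by simp
    have "(?f has_real_derivative (- 1 - y + 1 / (1 - y))) (at y)"
      using \<open>y < 1\<close> by (auto intro!: derivative_eq_intros simp: field_simps)
    moreover have "- 1 - y + 1 / (1 - y) = y\<^sup>2 / (1 - y)"
      using \<open>y < 1\<close> by (simp add: field_simps power2_eq_square)
    ultimately show "\<exists>d. (?f has_real_derivative d) (at y) \<and> 0 \<le> d"
      using \<open>y < 1\<close> by (intro exI[of _ "y\<^sup>2 / (1 - y)"]) auto
  qed
  then show ?thesis by simp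
qed

lemma exp_mult_one_minus_power_le:
  fixes \<epsilon> :: real
  assumes "0 < \<epsilon>" "\<epsilon> < 1" "2 * ln (1 / \<epsilon>) / \<epsilon>\<^sup>2 \<le> real k"
  shows "exp (\<epsilon> * real k) * (1 - \<epsilon>) ^ k \<le> \<epsilon>"
proof -
  have exponent: "real k * (- \<epsilon>\<^sup>2 / 2) \<le> ln \<epsilon>"
    using assms by (simp add: field_simps ln_div)
  have "exp (\<epsilon> * real k) * (1 - \<epsilon>) ^ k = exp (real k * (\<epsilon> + ln (1 - \<epsilon>)))"
    using assms(2) by (simp add: exp_add distrib_left exp_of_nat_mult mult.commute)
  also have "\<dots> \<le> exp (real k * (- \<epsilon>\<^sup>2 / 2))"
    using ln_one_minus_le[of \<epsilon>] assms by (intro iffD2[OF exp_le_cancel_iff] mult_left_mono) auto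
  also have "\<dots> \<le> exp (ln \<epsilon>)"
    using exponent by (rule iffD2[OF exp_le_cancel_iff])
  finally show ?thesis using assms by simp
qed


subsection \<open>Random subsets of bounded cardinality\<close>

definition realizable_marginals :: "'a set \<Rightarrow> enat \<Rightarrow> ('a \<Rightarrow> real) \<Rightarrow> bool" where
  "realizable_marginals A c z \<longleftrightarrow>
     (\<exists>D. set_pmf D \<subseteq> {S. S \<subseteq> A \<and> enat (card S) \<le> c} \<and>
       (\<forall>a\<in>A. measure_pmf.prob D {S. a \<in> S} = z a))"

lemma realizable_marginals_convex:
  assumes "realizable_marginals A c z1" "realizable_marginals A c z2"
    and weight: "0 \<le> r" "r \<le> 1"
    and combination: "\<And>a. a \<in> A \<Longrightarrow> z a = r * z1 a + (1 - r) * z2 a"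
  shows "realizable_marginals A c z"
proof -
  obtain D1 where D1: "set_pmf D1 \<subseteq> {S. S \<subseteq> A \<and> enat (card S) \<le> c}"
      "\<And>a. a \<in> A \<Longrightarrow> measure_pmf.prob D1 {S. a \<in> S} = z1 a"
    using assms(1) by (auto simp: realizable_marginals_def)
  obtain D2 where D2: "set_pmf D2 \<subseteq> {S. S \<subseteq> A \<and> enat (card S) \<le> c}"
      "\<And>a. a \<in> A \<Longrightarrow> measure_pmf.prob D2 {S. a \<in> S} = z2 a"
    using assms(2) by (auto simp: realizable_marginals_def)
  define D where "D = bind_pmf (bernoulli_pmf r) (\<lambda>b. if b then D1 else D2)"
  have "set_pmf D \<subseteq> {S. S \<subseteq> A \<and> enat (card S) \<le> c}"
    using D1(1) D2(1) by (fastforce simp: D_def split: if_splits)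
  moreover have "measure_pmf.prob D {S. a \<in> S} = z a" if "a \<in> A" for a
    using D1(2)[OF that] D2(2)[OF that] combination[OF that] weight
    by (simp add: D_def measure_bind_pmf mult.commute)
  ultimately show ?thesis
    by (auto simp: realizable_marginals_def)
qed

definition fractional :: "'a set \<Rightarrow> ('a \<Rightarrow> real) \<Rightarrow> 'a set" where
  "fractional A z = {a \<in> A. 0 < z a \<and> z a < 1}"

lemma integral_coordinate:
  assumes "z \<in> A \<rightarrow> {0..1}" "fractional A z = {}" "a \<in> A"
  shows "z a = 0 \<or> z a = 1"
  using assms by (fastforce simp: fractional_def Pi_iff less_le)

lemma sum_eq_card_if_not_fractional:
  assumes "finite A" "z \<in> A \<rightarrow> {0..1}" "fractional A z = {}"
  shows "sum z A = real (card {a \<in> A. z a = 1})"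
proof -
  have "z a = (if z a = 1 then 1 else 0)" if "a \<in> A" for a
    using integral_coordinate[OF assms(2,3) that] by auto
  then have "sum z A = (\<Sum>a\<in>A. if z a = 1 then 1 else 0)"
    by (rule sum.cong[OF refl])
  then show ?thesis
    using assms(1) by (simp add: sum.If_cases Int_def)
qed

lemma realizable_marginals_if_not_fractional:
  assumes "finite A" "z \<in> A \<rightarrow> {0..1}" "sum z A \<le> real k" "fractional A z = {}"
  shows "realizable_marginals A (enat k) z"
  unfolding realizable_marginals_def
proof (intro exI conjI ballI)
  let ?S = "{a \<in> A. z a = 1}"
  show "set_pmf (return_pmf ?S) \<subseteq> {S. S \<subseteq> A \<and> enat (card S) \<le> enat k}"
    using sum_eq_card_if_not_fractional[OF assms(1,2,4)] assms(3) by auto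
  show "measure_pmf.prob (return_pmf ?S) {S. a \<in> S} = z a" if "a \<in> A" for a
    using integral_coordinate[OF assms(2,4) that] that by auto
qed

text \<open>The other coordinates have an integer sum, so \<open>sum z A \<le> k\<close> leaves room to round \<open>a\<close> up.\<close>

lemma realizable_marginals_if_one_fractional:
  assumes fin: "finite A" and z_unit: "z \<in> A \<rightarrow> {0..1}" and z_sum: "sum z A \<le> real k"
    and frac: "fractional A z = {a}"
  shows "realizable_marginals A (enat k) z"
proof -
  have a_frac: "a \<in> A" "0 < z a" "z a < 1"
    using frac by (auto simp: fractional_def)
  define m where "m = card {b \<in> A - {a}. z b = 1}"
  have rest: "sum z (A - {a}) = real m"
    unfolding m_def using fin z_unit frac
    by (intro sum_eq_card_if_not_fractional) (auto simp: fractional_def)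
  then have "m < k"
    using a_frac z_sum fin by (simp add: sum.remove)
  then have room: "real (Suc m) \<le> real k"
    by (intro of_nat_mono Suc_leI)
  have rounded: "realizable_marginals A (enat k) (z(a := r))" if zero_one: "r = 0 \<or> r = 1" for r
  proof (rule realizable_marginals_if_not_fractional[OF fin])
    show "z(a := r) \<in> A \<rightarrow> {0..1}"
      using z_unit zero_one by (auto simp: Pi_iff)
    show "sum (z(a := r)) A \<le> real k"
      using a_frac fin rest room zero_one
      by (auto simp: sum.remove[of A a] cong: sum.cong_simp)
    show "fractional A (z(a := r)) = {}"
      using frac zero_one by (auto simp: fractional_def)
  qed
  show ?thesis
    by (rule realizable_marginals_convex[OF rounded[of 1] rounded[of 0], of "z a"])
      (use a_frac in \<open>auto simp: algebra_simps\<close>)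
qed

lemma shift_until_integral:
  assumes fin: "finite A" and z_unit: "z \<in> A \<rightarrow> {0..1}"
    and ab: "a \<in> fractional A z" "b \<in> fractional A z" and distinct: "a \<noteq> b"
  obtains s where "0 < s"
    "z(a := z a + s, b := z b - s) \<in> A \<rightarrow> {0..1}"
    "sum (z(a := z a + s, b := z b - s)) A = sum z A"
    "fractional A (z(a := z a + s, b := z b - s)) \<subset> fractional A z"
proof
  define s where "s = min (1 - z a) (z b)"
  let ?z = "z(a := z a + s, b := z b - s)"
  have ab_frac: "a \<in> A" "0 < z a" "z a < 1" "b \<in> A" "0 < z b" "z b < 1"
    using ab by (auto simp: fractional_def)
  show "0 < s"
    using ab_frac by (simp add: s_def)
  then show "?z \<in> A \<rightarrow> {0..1}"
    using z_unit ab_frac by (auto simp: s_def Pi_iff)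
  show "sum ?z A = sum z A"
    using fin ab_frac distinct
    by (simp add: sum.remove[of A a] sum.remove[of "A - {a}" b] cong: sum.cong_simp)
  have "?z a = 1 \<or> ?z b = 0"
    using distinct by (auto simp: s_def min_def)
  then have "a \<notin> fractional A ?z \<or> b \<notin> fractional A ?z"
    by (auto simp: fractional_def)
  moreover have "fractional A ?z \<subseteq> fractional A z"
    using ab_frac by (auto simp: fractional_def)
  ultimately show "fractional A ?z \<subset> fractional A z"
    using ab by blast
qed

lemma realizable_marginals_between_shifts:
  assumes distinct: "a \<noteq> b" and pos: "0 < s" "0 < t"
    and up: "realizable_marginals A c (z(a := z a + s, b := z b - s))"
    and down: "realizable_marginals A c (z(b := z b + t, a := z a - t))"
  shows "realizable_marginals A c z"
proof (rule realizable_marginals_convex[OF up down])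
  define r where "r = t / (s + t)"
  show "0 \<le> r" "r \<le> 1"
    using pos by (auto simp: r_def)
  have "r * s = (1 - r) * t"
    using pos by (simp add: r_def field_simps)
  then show "z i = r * (z(a := z a + s, b := z b - s)) i
      + (1 - r) * (z(b := z b + t, a := z a - t)) i" for i
    using distinct by (auto simp: algebra_simps)
qed

lemma realizable_marginals_if_sum_le_nat:
  assumes "finite A" "z \<in> A \<rightarrow> {0..1}" "sum z A \<le> real k"
  shows "realizable_marginals A (enat k) z"
  using assms(2,3)
proof (induction "card (fractional A z)" arbitrary: z rule: less_induct)
  case (less z)
  have smaller: "realizable_marginals A (enat k) z'"
    if "fractional A z' \<subset> fractional A z" "z' \<in> A \<rightarrow> {0..1}" "sum z' A = sum z A" for z'
  proof -
    have "card (fractional A z') < card (fractional A z)"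
      using that(1) assms(1) by (intro psubset_card_mono) (simp_all add: fractional_def)
    then show ?thesis
      using less.hyps that(2,3) less.prems(2) by simp
  qed
  consider (none) "fractional A z = {}" | (one) a where "fractional A z = {a}"
    | (two) a b where "a \<in> fractional A z" "b \<in> fractional A z" "a \<noteq> b"
    by blast
  then show ?case
  proof cases
    case none
    then show ?thesis
      by (rule realizable_marginals_if_not_fractional[OF assms(1) less.prems])
  next
    case (one a)
    then show ?thesis
      by (rule realizable_marginals_if_one_fractional[OF assms(1) less.prems])
  next
    case (two a b)
    have "\<exists>s>0. realizable_marginals A (enat k) (z(i := z i + s, j := z j - s))"
      if "i \<in> fractional A z" "j \<in> fractional A z" "i \<noteq> j" for i j
      by (rule shift_until_integral[OF assms(1) less.prems(1) that]) (blast intro: smaller)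
    from this[OF two] this[OF two(2,1)] two(3)
    show ?thesis
      by (blast intro: realizable_marginals_between_shifts)
  qed
qed

lemma realizable_marginals_mono:
  "realizable_marginals A c z \<Longrightarrow> c \<le> c' \<Longrightarrow> realizable_marginals A c' z"
  by (fastforce simp: realizable_marginals_def)

lemma realizable_marginals_if_sum_le:
  assumes "finite A" "z \<in> A \<rightarrow> {0..1}" "ereal (sum z A) \<le> ereal_of_enat c"
  shows "realizable_marginals A c z"
proof (cases c)
  case (enat k)
  then show ?thesis
    using realizable_marginals_if_sum_le_nat[OF assms(1,2)] assms(3) by simp
next
  case infinity
  have "sum z A \<le> real (card A)"
    using sum_bounded_above[of A z 1] assms(2) by (auto simp: Pi_iff)
  then have "realizable_marginals A (enat (card A)) z"
    by (rule realizable_marginals_if_sum_le_nat[OF assms(1,2)])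
  then show ?thesis
    using infinity by (simp add: realizable_marginals_mono)
qed


subsection \<open>Optimal revenue\<close>

lemma is_maximum_exists_if_finite_dominating:
  assumes "finite T" "T \<subseteq> S" "S \<noteq> {}" and dominating: "\<And>s. s \<in> S \<Longrightarrow> \<exists>t\<in>T. s \<le> t"
  shows "\<exists>z. is_maximum S z"
proof -
  have "T \<noteq> {}"
    using assms(3) dominating by blast
  then have "is_maximum S (Max T)"
    unfolding is_maximum_def using assms(1,2) dominating
    by (meson Max_ge Max_in order_trans subsetD)
  then show ?thesis ..
qed

text \<open>For a fixed \<open>F\<close> it is best to raise every left price to the smallest budget it has to meet,
  so only finitely many solutions compete for the optimum.\<close>

definition best_prices :: "('v, 'e) pricing \<Rightarrow> 'e set \<Rightarrow> 'v \<Rightarrow> real" where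
  "best_prices I F w = (if w \<in> lverts I \<and> F \<inter> incident I w \<noteq> {}
     then Min (budget I ` (F \<inter> incident I w)) else 0)"

locale pricing_graph =
  fixes I :: "('v, 'e) pricing"
  assumes inst: "pricing_instance I"
begin

lemma finite_lverts: "finite (lverts I)"
  and finite_edges: "finite (edges I)"
  using inst by (auto simp: pricing_instance_def)

lemma
  assumes "e \<in> edges I"
  shows lend_lvert: "lend I e \<in> lverts I" and rend_rvert: "rend I e \<in> rverts I"
    and rend_not_lvert: "rend I e \<notin> lverts I" and budget_nonneg: "0 \<le> budget I e"
    and incident_lend: "e \<in> incident I (lend I e)" and incident_rend: "e \<in> incident I (rend I e)"
  using inst assms by (auto simp: pricing_instance_def incident_def)

lemma rvert_not_lvert: "v \<in> rverts I \<Longrightarrow> v \<notin> lverts I"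
  using inst by (auto simp: pricing_instance_def)

lemma incident_left: "u \<in> lverts I \<Longrightarrow> e \<in> incident I u \<longleftrightarrow> e \<in> edges I \<and> lend I e = u"
  using rend_not_lvert by (auto simp: incident_def)

lemma incident_right: "v \<in> rverts I \<Longrightarrow> e \<in> incident I v \<longleftrightarrow> e \<in> edges I \<and> rend I e = v"
  using lend_lvert rvert_not_lvert by (auto simp: incident_def)

lemma finite_incident: "finite (incident I w)"
  using finite_edges by (simp add: incident_def)

lemma finite_prices: "finite (prices I u)"
  using finite_incident by (simp add: prices_def)

lemma finite_edge_prices: "finite (edge_prices I e)"
  using finite_prices by (simp add: edge_prices_def)

lemma prices_nonneg: "p \<in> prices I u \<Longrightarrow> 0 \<le> p"
  using budget_nonneg by (auto simp: prices_def incident_def)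

lemma edge_prices_nonneg: "p \<in> edge_prices I e \<Longrightarrow> 0 \<le> p"
  by (auto simp: edge_prices_def intro: prices_nonneg)

lemma feasible_empty: "feasible I (\<lambda>_. 0) {}"
  by (simp add: feasible_def zero_enat_def[symmetric])

lemma best_prices_lend:
  assumes "e \<in> F" "F \<subseteq> edges I"
  shows "best_prices I F (lend I e) = Min (budget I ` (F \<inter> incident I (lend I e)))"
  using assms lend_lvert[of e] incident_lend[of e] by (auto simp: best_prices_def)

lemma best_prices_rvert: "v \<in> rverts I \<Longrightarrow> best_prices I F v = 0"
  using rvert_not_lvert by (simp add: best_prices_def)

lemma finite_budgets: "finite (budget I ` (F \<inter> incident I w))"
  using finite_incident by simp

lemma feasible_best_prices:
  assumes "feasible I p F"
  shows "feasible I (best_prices I F) F"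
proof -
  have "F \<subseteq> edges I"
    using assms by (simp add: feasible_def)
  have "0 \<le> best_prices I F w" for w
    using finite_budgets budget_nonneg
    by (auto simp: best_prices_def incident_def intro!: Min.boundedI)
  moreover have "best_prices I F (lend I e) + best_prices I F (rend I e) \<le> budget I e"
    if "e \<in> F" for e
  proof -
    have "e \<in> edges I"
      using that \<open>F \<subseteq> edges I\<close> by blast
    then have "best_prices I F (rend I e) = 0"
      by (intro best_prices_rvert rend_rvert)
    moreover have "best_prices I F (lend I e) \<le> budget I e"
      using that \<open>e \<in> edges I\<close> incident_lend
      by (auto simp: best_prices_lend[OF that \<open>F \<subseteq> edges I\<close>] intro!: Min_le finite_budgets)
    ultimately show ?thesis by simp
  qed
  ultimately show ?thesis
    using assms best_prices_rvert by (simp add: feasible_def)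
qed

lemma revenue_le_revenue_best_prices:
  assumes "feasible I p F"
  shows "revenue I p F \<le> revenue I (best_prices I F) F"
  unfolding revenue_def
proof (rule sum_mono)
  fix e assume "e \<in> F"
  have "F \<subseteq> edges I"
    using assms by (simp add: feasible_def)
  then have "e \<in> edges I"
    using \<open>e \<in> F\<close> by blast
  have p_rend: "p (rend I e') = 0" if "e' \<in> F" for e'
    using assms that rend_rvert by (auto simp: feasible_def)
  have "p (lend I e) \<le> budget I e'" if "e' \<in> F \<inter> incident I (lend I e)" for e'
  proof -
    have "lend I e' = lend I e"
      using that incident_left[OF lend_lvert[OF \<open>e \<in> edges I\<close>]] by blast
    then show ?thesis
      using assms that p_rend[of e'] by (force simp: feasible_def)
  qed
  moreover have "e \<in> F \<inter> incident I (lend I e)"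
    using \<open>e \<in> F\<close> incident_lend[OF \<open>e \<in> edges I\<close>] by blast
  ultimately have "p (lend I e) \<le> best_prices I F (lend I e)"
    unfolding best_prices_lend[OF \<open>e \<in> F\<close> \<open>F \<subseteq> edges I\<close>]
    by (intro Min.boundedI finite_budgets) auto
  then show "p (lend I e) + p (rend I e)
      \<le> best_prices I F (lend I e) + best_prices I F (rend I e)"
    using p_rend[OF \<open>e \<in> F\<close>] best_prices_rvert[OF rend_rvert[OF \<open>e \<in> edges I\<close>]] by simp
qed

lemma optimum_revenue_exists: "\<exists>opt. optimum_revenue I opt"
  unfolding optimum_revenue_def
proof (rule is_maximum_exists_if_finite_dominating)
  let ?T = "{revenue I (best_prices I F) F | F. feasible I (best_prices I F) F}"
  have "?T \<subseteq> (\<lambda>F. revenue I (best_prices I F) F) ` Pow (edges I)"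
    by (auto simp: feasible_def)
  then show "finite ?T"
    by (rule finite_subset) (simp add: finite_edges)
  show "?T \<subseteq> {revenue I p F | p F. feasible I p F}"
    by blast
  show "{revenue I p F | p F. feasible I p F} \<noteq> {}"
    using feasible_empty by blast
  show "\<exists>t\<in>?T. r \<le> t" if "r \<in> {revenue I p F | p F. feasible I p F}" for r
  proof -
    from that obtain p F where "r = revenue I p F" "feasible I p F"
      by blast
    then have "r \<le> revenue I (best_prices I F) F" "feasible I (best_prices I F) F"
      using revenue_le_revenue_best_prices feasible_best_prices by simp_all
    then show ?thesis by blast
  qed
qed

lemma revenue_le_optimum:
  "optimum_revenue I opt \<Longrightarrow> feasible I p F \<Longrightarrow> revenue I p F \<le> opt"
  by (auto simp: optimum_revenue_def is_maximum_def)

end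


subsection \<open>Randomized rounding of the linear program\<close>

abbreviation affordable :: "('v, 'e) pricing \<Rightarrow> 'v \<Rightarrow> real \<Rightarrow> 'e set" where
  "affordable I u p \<equiv> {e. e \<in> incident I u \<and> p \<le> budget I e}"

lemma
  assumes "lp_feasible I x y"
  shows lp_y_nonneg: "\<And>u p. u \<in> lverts I \<Longrightarrow> p \<in> prices I u \<Longrightarrow> 0 \<le> y u p"
    and lp_x_nonneg: "\<And>e p. e \<in> edges I \<Longrightarrow> p \<in> edge_prices I e \<Longrightarrow> 0 \<le> x e p"
    and lp_y_sum: "\<And>u. u \<in> lverts I \<Longrightarrow> (\<Sum>p\<in>prices I u. y u p) = 1"
    and lp_cap_left: "\<And>u p. u \<in> lverts I \<Longrightarrow> p \<in> prices I u \<Longrightarrow>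
      ereal (\<Sum>e\<in>affordable I u p. x e p) \<le> ereal_of_enat (cap I u) * ereal (y u p)"
    and lp_cap_right: "\<And>v. v \<in> rverts I \<Longrightarrow>
      ereal (\<Sum>e\<in>incident I v. \<Sum>p\<in>edge_prices I e. x e p) \<le> ereal_of_enat (cap I v)"
    and lp_x_le_y: "\<And>u e p. u \<in> lverts I \<Longrightarrow> e \<in> incident I u \<Longrightarrow> p \<in> edge_prices I e \<Longrightarrow>
      x e p \<le> y u p"
  using assms unfolding lp_feasible_def by blast+

definition offers :: "('v, 'e) pricing \<Rightarrow> 'v \<Rightarrow> (real \<times> 'e set) set" where
  "offers I u =
     (SIGMA p:prices I u. {S. S \<subseteq> affordable I u p \<and> enat (card S) \<le> cap I u})"

abbreviation edge_offers :: "'e \<Rightarrow> real \<Rightarrow> (real \<times> 'e set) set" where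
  "edge_offers e p \<equiv> {p} \<times> {S. e \<in> S}"

context pricing_graph
begin

lemma lp_value_nonneg: "lp_feasible I x y \<Longrightarrow> 0 \<le> lp_value I x"
  unfolding lp_value_def
  by (intro sum_nonneg mult_nonneg_nonneg) (auto intro: edge_prices_nonneg lp_x_nonneg)

lemma finite_offers: "finite (offers I u)"
  unfolding offers_def using finite_prices finite_incident by auto

text \<open>Where \<open>y u p = 0\<close>, also \<open>x e p = 0\<close>, and the quotient below is \<open>0\<close>.\<close>

lemma realizable_lp_marginals:
  assumes feas: "lp_feasible I x y" and left: "u \<in> lverts I" and price: "p \<in> prices I u"
    and s_unit: "0 \<le> s" "s \<le> 1"
  shows "realizable_marginals (affordable I u p) (cap I u) (\<lambda>e. s * x e p / y u p)"
    (is "realizable_marginals ?A _ ?z")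
proof (rule realizable_marginals_if_sum_le)
  show "finite ?A"
    using finite_incident by simp
  have y_nonneg: "0 \<le> y u p"
    using lp_y_nonneg[OF feas left price] .
  have x_bounds: "0 \<le> x e p" "x e p \<le> y u p" if "e \<in> ?A" for e
    using that price lp_x_nonneg[OF feas] lp_x_le_y[OF feas left] incident_left[OF left]
    by (auto simp: edge_prices_def)
  show "?z \<in> ?A \<rightarrow> {0..1}"
  proof
    fix e assume affordable: "e \<in> ?A"
    have "s * x e p \<le> 1 * y u p"
      using x_bounds[OF affordable] s_unit by (intro mult_mono) auto
    then show "?z e \<in> {0..1}"
      using x_bounds[OF affordable] s_unit y_nonneg by (auto simp: divide_le_eq_1)
  qed
  show "ereal (sum ?z ?A) \<le> ereal_of_enat (cap I u)"
  proof (cases "cap I u")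
    case (enat n)
    have "sum ?z ?A = s * ((\<Sum>e\<in>?A. x e p) / y u p)"
      by (simp add: sum_distrib_left sum_divide_distrib)
    also have "\<dots> \<le> 1 * real n"
    proof (rule mult_mono)
      show "(\<Sum>e\<in>?A. x e p) / y u p \<le> real n"
        using lp_cap_left[OF feas left price] y_nonneg enat
        by (cases "y u p = 0") (auto simp: field_simps)
      show "0 \<le> (\<Sum>e\<in>?A. x e p) / y u p"
        using x_bounds y_nonneg by (intro divide_nonneg_nonneg sum_nonneg) auto
    qed (use s_unit in auto)
    finally show ?thesis
      using enat by simp
  qed simp
qed

lemma offer_pmf_exists:
  assumes feas: "lp_feasible I x y" and left: "u \<in> lverts I" and s_unit: "0 \<le> s" "s \<le> 1"
  shows "\<exists>D. set_pmf D \<subseteq> offers I u \<and> (\<forall>e\<in>incident I u. \<forall>p\<in>edge_prices I e.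
    measure_pmf.prob D (edge_offers e p) = s * x e p)"
proof -
  obtain Y where set_Y: "set_pmf Y \<subseteq> prices I u"
    and pmf_Y: "\<And>p. p \<in> prices I u \<Longrightarrow> pmf Y p = y u p"
    using pmf_of_weights_exists[OF finite_prices lp_y_nonneg[OF feas left] lp_y_sum[OF feas left]]
    by blast
  have "\<forall>p\<in>prices I u. \<exists>T.
      set_pmf T \<subseteq> {S. S \<subseteq> affordable I u p \<and> enat (card S) \<le> cap I u} \<and>
      (\<forall>e\<in>affordable I u p. measure_pmf.prob T {S. e \<in> S} = s * x e p / y u p)"
    using realizable_lp_marginals[OF feas left _ s_unit] unfolding realizable_marginals_def by blast
  from bchoice[OF this] obtain T where T: "\<forall>p\<in>prices I u.
      set_pmf (T p) \<subseteq> {S. S \<subseteq> affordable I u p \<and> enat (card S) \<le> cap I u} \<and>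
      (\<forall>e\<in>affordable I u p. measure_pmf.prob (T p) {S. e \<in> S} = s * x e p / y u p)" ..
  define D where "D = bind_pmf Y (\<lambda>p. map_pmf (Pair p) (T p))"
  have "set_pmf D \<subseteq> offers I u"
    using set_Y T by (fastforce simp: D_def offers_def)
  moreover have "measure_pmf.prob D (edge_offers e p) = s * x e p"
    if incident: "e \<in> incident I u" and edge_price: "p \<in> edge_prices I e" for e p
  proof -
    have price: "p \<in> prices I u" and affordable: "e \<in> affordable I u p"
      using incident edge_price incident_left[OF left] by (auto simp: edge_prices_def)
    have "measure_pmf.prob D (edge_offers e p) = y u p * (s * x e p / y u p)"
      using T price affordable pmf_Y[OF price] by (simp add: D_def measure_bind_pmf_map_Pair)
    also have "\<dots> = s * x e p"
      using lp_x_nonneg[OF feas _ edge_price] lp_x_le_y[OF feas left incident edge_price]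
        incident incident_left[OF left] by auto
    finally show ?thesis .
  qed
  ultimately show ?thesis by blast
qed

end

definition crowded :: "('v, 'e) pricing \<Rightarrow> ('v \<Rightarrow> real \<times> 'e set) \<Rightarrow> 'e \<Rightarrow> bool" where
  "crowded I g e \<longleftrightarrow> cap I (rend I e)
     \<le> enat (card {e' \<in> incident I (rend I e) - {e}. e' \<in> snd (g (lend I e'))})"

definition kept_edges :: "('v, 'e) pricing \<Rightarrow> ('v \<Rightarrow> real \<times> 'e set) \<Rightarrow> 'e set" where
  "kept_edges I g = {e \<in> edges I. e \<in> snd (g (lend I e)) \<and> \<not> crowded I g e}"

text \<open>The default \<open>(0, {})\<close> makes \<open>fst \<circ> g\<close> vanish on the right vertices, as a price function must.\<close>

abbreviation offer_profiles :: "('v, 'e) pricing \<Rightarrow> ('v \<Rightarrow> real \<times> 'e set) set" where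
  "offer_profiles I \<equiv> PiE_dflt (lverts I) (0, {}) (offers I)"

abbreviation profile_revenue :: "('v, 'e) pricing \<Rightarrow> ('v \<Rightarrow> real \<times> 'e set) \<Rightarrow> real" where
  "profile_revenue I g \<equiv> revenue I (fst \<circ> g) (kept_edges I g)"

context pricing_graph
begin

lemma
  assumes "g \<in> offer_profiles I"
  shows offer_price: "u \<in> lverts I \<Longrightarrow> fst (g u) \<in> prices I u"
    and offered_edges_affordable: "u \<in> lverts I \<Longrightarrow> snd (g u) \<subseteq> affordable I u (fst (g u))"
    and card_offered_edges_le: "u \<in> lverts I \<Longrightarrow> enat (card (snd (g u))) \<le> cap I u"
    and offer_outside_lverts: "u \<notin> lverts I \<Longrightarrow> g u = (0, {})"
  using assms by (force simp: PiE_dflt_def offers_def)+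

lemma card_kept_edges_le_cap_left:
  assumes profile: "g \<in> offer_profiles I" and left: "u \<in> lverts I"
  shows "enat (card (kept_edges I g \<inter> incident I u)) \<le> cap I u"
proof -
  have "kept_edges I g \<inter> incident I u \<subseteq> snd (g u)"
    using incident_left[OF left] by (auto simp: kept_edges_def)
  moreover have "finite (snd (g u))"
    using offered_edges_affordable[OF profile left] finite_incident[of u]
    by (auto intro: finite_subset)
  ultimately have "card (kept_edges I g \<inter> incident I u) \<le> card (snd (g u))"
    by (rule card_mono[rotated])
  then show ?thesis
    using card_offered_edges_le[OF profile left] by (meson enat_ord_simps(1) order_trans)
qed

lemma card_kept_edges_le_cap_right:
  assumes right: "v \<in> rverts I"
  shows "enat (card (kept_edges I g \<inter> incident I v)) \<le> cap I v"
proof (cases "kept_edges I g \<inter> incident I v = {}")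
  case True
  then show ?thesis by (simp add: zero_enat_def[symmetric])
next
  case False
  then obtain e where kept: "e \<in> kept_edges I g" "rend I e = v"
    using incident_right[OF right] by blast
  let ?others = "{e' \<in> incident I v - {e}. e' \<in> snd (g (lend I e'))}"
  have fin: "finite ?others"
    using finite_incident by simp
  have "kept_edges I g \<inter> incident I v \<subseteq> insert e ?others"
    by (auto simp: kept_edges_def)
  then have "card (kept_edges I g \<inter> incident I v) \<le> card (insert e ?others)"
    using fin by (intro card_mono) auto
  also have "\<dots> = Suc (card ?others)"
    using fin by simp
  finally have "enat (card (kept_edges I g \<inter> incident I v)) \<le> eSuc (enat (card ?others))"
    by (simp add: eSuc_enat)
  also have "\<dots> \<le> cap I v"
    using kept by (auto simp: kept_edges_def crowded_def intro!: ileI1)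
  finally show ?thesis .
qed

lemma feasible_kept_edges:
  assumes profile: "g \<in> offer_profiles I"
  shows "feasible I (fst \<circ> g) (kept_edges I g)"
  unfolding feasible_def
proof (intro conjI ballI)
  show "0 \<le> (fst \<circ> g) w" for w
    using offer_price[OF profile, of w] offer_outside_lverts[OF profile, of w] prices_nonneg
    by (cases "w \<in> lverts I") auto
  show price_right: "(fst \<circ> g) v = 0" if "v \<in> rverts I" for v
    using offer_outside_lverts[OF profile rvert_not_lvert[OF that]] by simp
  show "kept_edges I g \<subseteq> edges I"
    by (auto simp: kept_edges_def)
  show "(fst \<circ> g) (lend I e) + (fst \<circ> g) (rend I e) \<le> budget I e" if "e \<in> kept_edges I g" for e
  proof -
    have "e \<in> edges I" "e \<in> snd (g (lend I e))"
      using that by (auto simp: kept_edges_def)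
    then show ?thesis
      using offered_edges_affordable[OF profile lend_lvert] price_right[OF rend_rvert] by auto
  qed
  show "enat (card (kept_edges I g \<inter> incident I w)) \<le> cap I w"
    if "w \<in> lverts I \<union> rverts I" for w
    using that card_kept_edges_le_cap_left[OF profile] card_kept_edges_le_cap_right by blast
qed

lemma revenue_kept_edges:
  assumes profile: "g \<in> offer_profiles I"
  shows "profile_revenue I g = (\<Sum>e\<in>edges I. \<Sum>p\<in>edge_prices I e.
    p * indicat_real {g. g (lend I e) \<in> edge_offers e p \<and> \<not> crowded I g e} g)"
proof -
  have "(\<Sum>p\<in>edge_prices I e.
      p * indicat_real {g. g (lend I e) \<in> edge_offers e p \<and> \<not> crowded I g e} g)
    = (if e \<in> kept_edges I g then fst (g (lend I e)) else 0)" (is "?lhs = ?rhs")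
    if edge: "e \<in> edges I" for e
  proof -
    let ?p = "fst (g (lend I e))"
    have "?lhs = (\<Sum>p\<in>edge_prices I e. if p = ?p then ?rhs else 0)"
      using edge by (intro sum.cong) (auto simp: kept_edges_def mem_Times_iff)
    moreover have "?p \<in> edge_prices I e" if "e \<in> kept_edges I g"
      using that offer_price[OF profile lend_lvert[OF edge]]
        offered_edges_affordable[OF profile lend_lvert[OF edge]]
      by (auto simp: kept_edges_def edge_prices_def)
    ultimately show ?thesis
      using finite_edge_prices by auto
  qed
  then have "(\<Sum>e\<in>edges I. \<Sum>p\<in>edge_prices I e.
      p * indicat_real {g. g (lend I e) \<in> edge_offers e p \<and> \<not> crowded I g e} g)
    = (\<Sum>e\<in>edges I. if e \<in> kept_edges I g then fst (g (lend I e)) else 0)"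
    by simp
  also have "\<dots> = (\<Sum>e\<in>edges I \<inter> kept_edges I g. fst (g (lend I e)))"
    using finite_edges by (simp add: sum.inter_restrict)
  also have "edges I \<inter> kept_edges I g = kept_edges I g"
    by (auto simp: kept_edges_def)
  also have "(\<Sum>e\<in>kept_edges I g. fst (g (lend I e))) = profile_revenue I g"
    unfolding revenue_def using offer_outside_lverts[OF profile rend_not_lvert]
    by (intro sum.cong) (auto simp: kept_edges_def)
  finally show ?thesis ..
qed

end

locale random_offers = pricing_graph I
  for I :: "('v, 'e) pricing" +
  fixes D :: "'v \<Rightarrow> (real \<times> 'e set) pmf"
  assumes simple: "simple_instance I"
    and set_D: "\<And>u. u \<in> lverts I \<Longrightarrow> set_pmf (D u) \<subseteq> offers I u"
begin

definition random_profile :: "('v \<Rightarrow> real \<times> 'e set) pmf" where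
  "random_profile = Pi_pmf (lverts I) (0, {}) D"

abbreviation prob_edge_offer :: "'e \<Rightarrow> real \<Rightarrow> real" where
  "prob_edge_offer e p \<equiv> measure_pmf.prob (D (lend I e)) (edge_offers e p)"

abbreviation prob_crowded :: "'e \<Rightarrow> real" where
  "prob_crowded e \<equiv> measure_pmf.prob random_profile {g. crowded I g e}"

lemma set_random_profile: "set_pmf random_profile \<subseteq> offer_profiles I"
  using set_D finite_lverts
  by (force simp: random_profile_def set_Pi_pmf PiE_dflt_def)

lemma finite_set_random_profile: "finite (set_pmf random_profile)"
  using set_random_profile
  by (rule finite_subset) (intro finite_PiE_dflt finite_lverts finite_offers)

lemma inj_on_lend_incident: "v \<in> rverts I \<Longrightarrow> inj_on (lend I) (incident I v)"
  using simple incident_right by (auto simp: simple_instance_def inj_on_def)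

lemma crowded_fun_upd:
  assumes "e \<in> edges I"
  shows "crowded I (g(lend I e := b)) e \<longleftrightarrow> crowded I g e"
proof -
  have "lend I e' \<noteq> lend I e" if "e' \<in> incident I (rend I e) - {e}" for e'
    using that inj_onD[OF inj_on_lend_incident[OF rend_rvert[OF assms]]] incident_rend[OF assms]
    by blast
  then have "{e' \<in> incident I (rend I e) - {e}. e' \<in> snd ((g(lend I e := b)) (lend I e'))}
      = {e' \<in> incident I (rend I e) - {e}. e' \<in> snd (g (lend I e'))}"
    by auto
  then show ?thesis by (simp only: crowded_def)
qed

lemma prob_edge_sold:
  assumes "e \<in> edges I"
  shows "measure_pmf.prob random_profile {g. g (lend I e) \<in> edge_offers e p \<and> \<not> crowded I g e}
    = prob_edge_offer e p * (1 - prob_crowded e)"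
proof -
  have "measure_pmf.prob random_profile {g. g (lend I e) \<in> edge_offers e p \<and> \<not> crowded I g e}
      = prob_edge_offer e p * measure_pmf.prob random_profile {g. \<not> crowded I g e}"
    unfolding random_profile_def
    by (rule measure_Pi_pmf_coordinate_indep)
      (simp_all add: finite_lverts lend_lvert[OF assms] crowded_fun_upd[OF assms])
  also have "measure_pmf.prob random_profile {g. \<not> crowded I g e} = 1 - prob_crowded e"
    using measure_pmf.prob_compl[of "{g. crowded I g e}" random_profile]
    by (simp add: Compl_eq_Diff_UNIV[symmetric] Collect_neg_eq)
  finally show ?thesis .
qed

lemma expectation_profile_revenue:
  "measure_pmf.expectation random_profile (profile_revenue I)
    = (\<Sum>e\<in>edges I. \<Sum>p\<in>edge_prices I e. p * (prob_edge_offer e p * (1 - prob_crowded e)))"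
proof -
  let ?sold = "\<lambda>e p. {g. g (lend I e) \<in> edge_offers e p \<and> \<not> crowded I g e}"
  have "measure_pmf.expectation random_profile (profile_revenue I)
      = measure_pmf.expectation random_profile
          (\<lambda>g. \<Sum>e\<in>edges I. \<Sum>p\<in>edge_prices I e. p * indicat_real (?sold e p) g)"
    using set_random_profile revenue_kept_edges
    by (intro integral_cong_AE) (auto simp: AE_measure_pmf_iff)
  also have "\<dots>
      = (\<Sum>e\<in>edges I. \<Sum>p\<in>edge_prices I e. p * measure_pmf.prob random_profile (?sold e p))"
    by (simp add: integrable_measure_pmf_finite finite_set_random_profile)
  finally show ?thesis
    by (simp add: prob_edge_sold)
qed

lemma prob_edge_offered_le:
  assumes "e \<in> edges I"
  shows "measure_pmf.prob random_profile {g. e \<in> snd (g (lend I e))}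
    \<le> (\<Sum>p\<in>edge_prices I e. prob_edge_offer e p)"
proof -
  let ?u = "lend I e"
  have "measure_pmf.prob random_profile {g. e \<in> snd (g ?u)}
      = measure_pmf.prob (map_pmf (\<lambda>g. g ?u) random_profile) {q. e \<in> snd q}"
    by simp
  also have "\<dots> = measure_pmf.prob (D ?u) {q. e \<in> snd q}"
    using finite_lverts lend_lvert[OF assms]
    by (simp add: random_profile_def Pi_pmf_component del: measure_map_pmf)
  also have "\<dots> = measure_pmf.prob (D ?u) ({q. e \<in> snd q} \<inter> set_pmf (D ?u))"
    by (simp add: measure_Int_set_pmf)
  also have "\<dots> \<le> measure_pmf.prob (D ?u) (\<Union>p\<in>edge_prices I e. edge_offers e p)"
    using set_D[OF lend_lvert[OF assms]]
    by (intro measure_pmf.finite_measure_mono) (force simp: offers_def edge_prices_def)+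
  also have "\<dots> \<le> (\<Sum>p\<in>edge_prices I e. prob_edge_offer e p)"
    by (intro measure_pmf.finite_measure_subadditive_finite finite_edge_prices) simp
  finally show ?thesis .
qed

lemma prob_crowded_le:
  assumes edge: "e \<in> edges I" and cap: "cap I (rend I e) = enat k" and t_ge_1: "1 \<le> t"
    and load: "(\<Sum>e'\<in>incident I (rend I e). \<Sum>p\<in>edge_prices I e'. prob_edge_offer e' p) \<le> \<mu>"
  shows "prob_crowded e \<le> exp ((t - 1) * \<mu>) / t ^ k"
proof -
  let ?J = "incident I (rend I e) - {e}"
  let ?P = "\<lambda>e'. measure_pmf.prob random_profile {g. e' \<in> snd (g (lend I e'))}"
  have right: "rend I e \<in> rverts I"
    using edge by (rule rend_rvert)
  have inj: "inj_on (lend I) ?J"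
    using inj_on_lend_incident[OF right] by (rule inj_on_subset) simp
  have "lend I ` ?J \<subseteq> lverts I"
    using incident_right[OF right] lend_lvert by auto
  then have indep: "prob_space.indep_vars (measure_pmf random_profile) (\<lambda>_. count_space UNIV)
      (\<lambda>e' g. e' \<in> snd (g (lend I e'))) ?J"
    unfolding random_profile_def
    by (intro indep_vars_Pi_pmf_reindex[OF finite_lverts inj])
  have "(\<Sum>e'\<in>?J. ?P e') \<le> (\<Sum>e'\<in>incident I (rend I e). ?P e')"
    using finite_incident by (intro sum_mono2) auto
  also have "\<dots> \<le> (\<Sum>e'\<in>incident I (rend I e). \<Sum>p\<in>edge_prices I e'. prob_edge_offer e' p)"
    using incident_right[OF right] by (intro sum_mono prob_edge_offered_le) simp
  finally have mean: "(\<Sum>e'\<in>?J. ?P e') \<le> \<mu>"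
    using load by simp
  have "measure_pmf.prob random_profile
      {g \<in> space random_profile. k \<le> card {e' \<in> ?J. e' \<in> snd (g (lend I e'))}}
    \<le> exp ((t - 1) * \<mu>) / t ^ k"
    by (rule prob_space.Chernoff_upper_tail[OF prob_space_measure_pmf _ indep t_ge_1])
      (use mean finite_incident in simp_all)
  then show ?thesis by (simp add: crowded_def cap)
qed

end

locale lp_rounding = random_offers I D
  for I :: "('v, 'e) pricing" and D :: "'v \<Rightarrow> (real \<times> 'e set) pmf" +
  fixes x :: "'e \<Rightarrow> real \<Rightarrow> real" and y :: "'v \<Rightarrow> real \<Rightarrow> real" and \<epsilon> :: real
  assumes feas: "lp_feasible I x y" and eps_pos: "0 < \<epsilon>" and eps_less_1: "\<epsilon> < 1"
    and marginal: "\<And>e p. e \<in> edges I \<Longrightarrow> p \<in> edge_prices I e \<Longrightarrow>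
      prob_edge_offer e p = (1 - \<epsilon>) * x e p"
    and large_cap: "\<And>v. v \<in> rverts I \<Longrightarrow>
      ereal (2 * ln (1 / \<epsilon>) / \<epsilon>\<^sup>2) \<le> ereal_of_enat (cap I v)"
begin

lemma prob_crowded_le_eps:
  assumes edge: "e \<in> edges I"
  shows "prob_crowded e \<le> \<epsilon>"
proof (cases "cap I (rend I e)")
  case (enat k)
  have right: "rend I e \<in> rverts I"
    using edge by (rule rend_rvert)
  have "(\<Sum>e'\<in>incident I (rend I e). \<Sum>p\<in>edge_prices I e'. prob_edge_offer e' p)
      = (1 - \<epsilon>) * (\<Sum>e'\<in>incident I (rend I e). \<Sum>p\<in>edge_prices I e'. x e' p)"
    using incident_right[OF right] marginal by (simp add: sum_distrib_left)
  also have "\<dots> \<le> (1 - \<epsilon>) * real k"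
    using lp_cap_right[OF feas right] enat eps_less_1 by (intro mult_left_mono) auto
  \<comment> \<open>\<open>t = 1 / (1 - \<epsilon>)\<close> minimises \<open>exp ((t - 1) * \<mu>) / t ^ k\<close> for \<open>\<mu> = (1 - \<epsilon>) * k\<close>\<close>
  finally have "prob_crowded e
      \<le> exp ((1 / (1 - \<epsilon>) - 1) * ((1 - \<epsilon>) * real k)) / (1 / (1 - \<epsilon>)) ^ k"
    using eps_pos eps_less_1 by (intro prob_crowded_le[OF edge enat]) auto
  also have "\<dots> = exp (\<epsilon> * real k) * (1 - \<epsilon>) ^ k"
    using eps_less_1 by (simp add: field_simps)
  also have "\<dots> \<le> \<epsilon>"
    using large_cap[OF right] enat eps_pos eps_less_1
    by (intro exp_mult_one_minus_power_le) auto
  finally show ?thesis .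
next
  case infinity
  then show ?thesis
    using eps_pos by (simp add: crowded_def)
qed

lemma expectation_profile_revenue_ge:
  "(1 - \<epsilon>)\<^sup>2 * lp_value I x \<le> measure_pmf.expectation random_profile (profile_revenue I)"
proof -
  have "(1 - \<epsilon>)\<^sup>2 * lp_value I x
      = (\<Sum>e\<in>edges I. \<Sum>p\<in>edge_prices I e. p * ((1 - \<epsilon>) * x e p * (1 - \<epsilon>)))"
    by (simp add: lp_value_def sum_distrib_left power2_eq_square mult_ac)
  also have "\<dots> \<le> (\<Sum>e\<in>edges I. \<Sum>p\<in>edge_prices I e.
      p * (prob_edge_offer e p * (1 - prob_crowded e)))"
    using marginal prob_crowded_le_eps eps_less_1 lp_x_nonneg[OF feas] edge_prices_nonneg
    by (intro sum_mono mult_left_mono mult_mono) auto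
  finally show ?thesis
    by (simp add: expectation_profile_revenue)
qed

lemma expectation_profile_revenue_le_optimum:
  assumes "optimum_revenue I opt"
  shows "measure_pmf.expectation random_profile (profile_revenue I) \<le> opt"
  using finite_set_random_profile set_random_profile
    revenue_le_optimum[OF assms feasible_kept_edges]
  by (intro measure_pmf.integral_le_const integrable_measure_pmf_finite)
    (auto simp: AE_measure_pmf_iff)

end

lemma (in pricing_graph) lp_rounding_exists:
  assumes "simple_instance I" and feas: "lp_feasible I x y" and eps: "0 < \<epsilon>" "\<epsilon> < 1"
    and "\<And>v. v \<in> rverts I \<Longrightarrow> ereal (2 * ln (1 / \<epsilon>) / \<epsilon>\<^sup>2) \<le> ereal_of_enat (cap I v)"
  shows "\<exists>D. lp_rounding I D x y \<epsilon>"
proof -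
  have "\<forall>u\<in>lverts I. \<exists>D. set_pmf D \<subseteq> offers I u \<and> (\<forall>e\<in>incident I u. \<forall>p\<in>edge_prices I e.
      measure_pmf.prob D (edge_offers e p) = (1 - \<epsilon>) * x e p)"
    using offer_pmf_exists[OF feas] eps by simp
  from bchoice[OF this] obtain D where D: "\<forall>u\<in>lverts I. set_pmf (D u) \<subseteq> offers I u \<and>
      (\<forall>e\<in>incident I u. \<forall>p\<in>edge_prices I e.
        measure_pmf.prob (D u) (edge_offers e p) = (1 - \<epsilon>) * x e p)" ..
  have "lp_rounding I D x y \<epsilon>"
    by unfold_locales (use assms D lend_lvert incident_lend in auto)
  then show ?thesis by blast
qed

lemma (in pricing_graph) lp_value_le_optimum_revenue:
  assumes "simple_instance I" and feas: "lp_feasible I x y" and eps_pos: "0 < \<epsilon>"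
    and large_cap: "\<And>v. v \<in> rverts I \<Longrightarrow>
      ereal (2 * ln (1 / \<epsilon>) / \<epsilon>\<^sup>2) \<le> ereal_of_enat (cap I v)"
    and opt: "optimum_revenue I opt"
  shows "(1 - 2 * \<epsilon>) * lp_value I x \<le> opt"
proof (cases "\<epsilon> < 1")
  case True
  then obtain D where "lp_rounding I D x y \<epsilon>"
    using lp_rounding_exists assms by blast
  then interpret lp_rounding I D x y \<epsilon> .
  have "(1 - 2 * \<epsilon>) * lp_value I x \<le> (1 - \<epsilon>)\<^sup>2 * lp_value I x"
    using lp_value_nonneg[OF feas]
    by (intro mult_right_mono) (simp_all add: power2_eq_square algebra_simps)
  also have "\<dots> \<le> measure_pmf.expectation random_profile (profile_revenue I)"
    by (rule expectation_profile_revenue_ge)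
  also have "\<dots> \<le> opt"
    by (rule expectation_profile_revenue_le_optimum[OF opt])
  finally show ?thesis .
next
  case False
  then have "(1 - 2 * \<epsilon>) * lp_value I x \<le> revenue I (\<lambda>_. 0) {}"
    using lp_value_nonneg[OF feas] by (simp add: revenue_def mult_nonpos_nonneg)
  also have "\<dots> \<le> opt"
    by (rule revenue_le_optimum[OF opt feasible_empty])
  finally show ?thesis .
qed

theorem theorem13:
  fixes I :: "('v, 'e) pricing" and \<epsilon> :: real
  assumes "\<epsilon> > 0"
    and "pricing_instance I"
    and "simple_instance I"
    and "\<And>v. v \<in> rverts I \<Longrightarrow> ereal_of_enat (cap I v) \<ge> ereal (3 * ln (1 / \<epsilon>) / \<epsilon>\<^sup>2 + 1)"
  shows "\<exists>opt. optimum_revenue I opt \<and> (\<forall>lp. lp_optimum I lp \<longrightarrow> opt \<ge> (1 - 2 * \<epsilon>) * lp)"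
proof -
  interpret pricing_graph I
    by unfold_locales fact
  obtain opt where opt: "optimum_revenue I opt"
    using optimum_revenue_exists by blast
  have "ln \<epsilon> \<le> \<epsilon>\<^sup>2"
    using ln_le_minus_one[OF assms(1)] zero_le_power2[of "\<epsilon> - 1"] assms(1)
    by (simp add: power2_diff)
  then have "2 * ln (1 / \<epsilon>) / \<epsilon>\<^sup>2 \<le> 3 * ln (1 / \<epsilon>) / \<epsilon>\<^sup>2 + 1"
    using assms(1) by (simp add: ln_div field_simps)
  then have large_cap: "ereal (2 * ln (1 / \<epsilon>) / \<epsilon>\<^sup>2) \<le> ereal_of_enat (cap I v)"
    if "v \<in> rverts I" for v
    using assms(4)[OF that] by (simp add: order_trans[rotated])
  have "(1 - 2 * \<epsilon>) * lp \<le> opt" if lp_opt: "lp_optimum I lp" for lp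
  proof -
    obtain x y where "lp_feasible I x y" "lp = lp_value I x"
      using lp_opt unfolding lp_optimum_def is_maximum_def by blast
    then show ?thesis
      using lp_value_le_optimum_revenue[OF assms(3) _ assms(1) large_cap opt] by simp
  qed
  then show ?thesis using opt by blast
qed

end
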